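(* For any ring $S\neq 0$ and any integer $n\ge 3$, the ring $\mathrm{M}_n(S)$ of $n\times n$ matrices over $S$ is not GSNC.
   Context: Rings are associative with identity, not necessarily commutative. An element $a$ of a ring $R$ is strongly nil-clean if $a=e+q$ with $e\in R$ idempotent, $q\in R$ nilpotent and $eq=qe$. A ring is generalized strongly nil-clean (GSNC) if every non-invertible element is strongly nil-clean. *)

theory Defs
  imports "Jordan_Normal_Form.Matrix"
begin

definition idempotent_elem :: "('a, 'b) ring_scheme \<Rightarrow> 'a \<Rightarrow> bool" where
  "idempotent_elem R e \<longleftrightarrow> e \<in> carrier R \<and> e \<otimes>\<^bsub>R\<^esub> e = e"

definition nilpotent_elem :: "('a, 'b) ring_scheme \<Rightarrow> 'a \<Rightarrow> bool" where
  "nilpotent_elem R q \<longleftrightarrow> q \<in> carrier R \<and> (\<exists>k::nat. q [^]\<^bsub>R\<^esub> k = \<zero>\<^bsub>R\<^esub>)"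

definition strongly_nil_clean :: "('a, 'b) ring_scheme \<Rightarrow> 'a \<Rightarrow> bool" where
  "strongly_nil_clean R a \<longleftrightarrow>
     (\<exists>e q. idempotent_elem R e \<and> nilpotent_elem R q \<and> a = e \<oplus>\<^bsub>R\<^esub> q \<and>
            e \<otimes>\<^bsub>R\<^esub> q = q \<otimes>\<^bsub>R\<^esub> e)"

text \<open>These predicates are meant for structures satisfying \<^term>\<open>ring R\<close>, which is not
  part of the definitions; \<^term>\<open>Units R\<close> is the set of two-sided invertible elements.\<close>

definition GSNC :: "('a, 'b) ring_scheme \<Rightarrow> bool" where
  "GSNC R \<longleftrightarrow> (\<forall>a \<in> carrier R - Units R. strongly_nil_clean R a)"

text \<open>The library states that matrices form a ring only over commutative coefficient rings;
  here they may be noncommutative.\<close>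

lemma ring_ring_mat: "ring (ring_mat TYPE('a :: ring_1) n b)"
proof -
  interpret semiring "ring_mat TYPE('a) n b" by (rule semiring_mat)
  show ?thesis
    by (unfold_locales, insert add_inv_exists_mat, auto simp: ring_mat_def Units_def algebra_simps)
qed

end

theory Submission
  imports Defs
begin

text \<open>If \<open>a = e + q\<close> is strongly nil-clean, then \<open>a\<^sup>2 - a = q (2e + q - 1)\<close> is nilpotent. The block
  matrix \<open>a\<close> with upper left block \<open>A = ((0, 1), (1, 1))\<close> and zeros elsewhere is not invertible as
  soon as \<open>n \<ge> 3\<close>, but \<open>A\<^sup>2 = A + 1\<close> makes \<open>a\<^sup>2 - a\<close> a nonzero idempotent.\<close>

lemma (in ring) strongly_nil_clean_idempotent_diff:
  assumes snc: "strongly_nil_clean R a"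
    and f: "f \<in> carrier R" "f \<otimes> f = f"
    and sq: "a \<otimes> a = a \<oplus> f"
  shows "f = \<zero>"
proof -
  obtain e q k where e: "e \<in> carrier R" "e \<otimes> e = e" and q: "q \<in> carrier R"
    and a: "a = e \<oplus> q" and comm: "e \<otimes> q = q \<otimes> e" and k: "q [^] (k::nat) = \<zero>"
    using snc unfolding strongly_nil_clean_def idempotent_elem_def nilpotent_elem_def by blast
  define c where "c = e \<oplus> e \<oplus> q \<ominus> \<one>"
  have c: "c \<in> carrier R" unfolding c_def using e q by simp
  have qc: "q \<otimes> c = c \<otimes> q"
    unfolding c_def using e q comm by (simp add: minus_eq l_distr r_distr l_minus r_minus)
  \<comment> \<open>Both expansions are sorted with \<open>e\<close> in front; the second keeps
    \<open>q\<close> next to \<open>\<ominus> q\<close>, the pair that \<open>r_neg2\<close>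
    cancels.\<close>
  have "a \<otimes> a = e \<oplus> (q \<otimes> e \<oplus> q \<otimes> e \<oplus> q \<otimes> q)"
    unfolding a using e q comm by (simp add: l_distr r_distr a_ac)
  moreover have "a \<oplus> q \<otimes> c = e \<oplus> (q \<oplus> (\<ominus> q \<oplus> (q \<otimes> e \<oplus> q \<otimes> e \<oplus> q \<otimes> q)))"
    unfolding a c_def using e q by (simp add: minus_eq r_distr r_minus a_ac)
  ultimately have "a \<otimes> a = a \<oplus> q \<otimes> c" using e q by (simp add: r_neg2)
  moreover have "a \<in> carrier R" using a e q by simp
  ultimately have fqc: "f = q \<otimes> c" using sq f q c by simp
  \<comment> \<open>The extra factor \<open>f\<close> covers the exponent 0, where the power is
    \<open>\<one>\<close> and not \<open>f\<close>.\<close>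
  have "f [^] m \<otimes> f = f" for m :: nat
    by (induction m) (use f in \<open>auto simp: m_assoc\<close>)
  then have "f = f [^] k \<otimes> f" by simp
  also have "f [^] k = q [^] k \<otimes> c [^] k"
    unfolding fqc by (rule pow_mult_distrib[OF qc q c])
  finally show ?thesis using k c f by simp
qed

theorem theorem4p9:
  fixes n :: nat
  assumes "n \<ge> 3"
  shows "\<not> GSNC (ring_mat TYPE('s :: ring_1) n ())"
proof
  let ?R = "ring_mat TYPE('s) n ()"
  assume G: "GSNC ?R"
  interpret ring ?R by (rule ring_ring_mat)
  define a :: "'s mat" where
    "a = mat n n (\<lambda>(i, j). if i < 2 \<and> j < 2 \<and> (i, j) \<noteq> (0, 0) then 1 else 0)"
  \<comment> \<open>The identity of the upper left block, padded with zeros.\<close>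
  define f :: "'s mat" where "f = mat n n (\<lambda>(i, j). if i < 2 \<and> i = j then 1 else 0)"
  have a: "a \<in> carrier_mat n n" and f: "f \<in> carrier_mat n n" by (auto simp: a_def f_def)
  \<comment> \<open>Two successors let the sums over indices shed their first two terms, the only
    ones that can be nonzero.\<close>
  obtain m where n: "n = Suc (Suc m)"
    using assms by (metis Suc_le_D numeral_3_eq_3 Suc_le_mono)
  have ff: "f * f = f"
    by (rule eq_matI) (auto simp: f_def scalar_prod_def n sum.atLeast0_lessThan_Suc_shift
        simp del: sum.op_ivl_Suc)
  have aa: "a * a = a + f"
    by (rule eq_matI) (auto simp: a_def f_def scalar_prod_def n sum.atLeast0_lessThan_Suc_shift
        less_2_cases_iff simp del: sum.op_ivl_Suc)
  have "a \<notin> Units ?R"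
  proof
    assume "a \<in> Units ?R"
    then obtain b where b: "b \<in> carrier_mat n n" "a * b = 1\<^sub>m n"
      by (auto simp: Units_def ring_mat_def)
    \<comment> \<open>The row of \<open>a\<close> with index 2 is zero; it exists because
      \<open>n \<ge> 3\<close>.\<close>
    have "(a * b) $$ (2, 2) = 0"
      using a b(1) assms by (simp add: a_def scalar_prod_def)
    then show False using b(2) assms by simp
  qed
  then have "strongly_nil_clean ?R a"
    using G a by (auto simp: GSNC_def ring_mat_simps)
  then have "f = 0\<^sub>m n n"
    using strongly_nil_clean_idempotent_diff[of a f] f ff aa by (simp add: ring_mat_simps)
  \<comment> \<open>This entry is 1, and \<open>0 \<noteq> 1\<close> in the class
    \<open>ring_1\<close>: here S is nonzero.\<close>
  then have "f $$ (0, 0) = 0" using n by simp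
  then show False by (simp add: f_def n)
qed

end
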